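(* The class of CCC spaces is closed with respect to products and continuous images: if $(X_i)_{i\in I}$ is any family of CCC spaces, then the topological product $\prod_{i\in I}X_i$ is a CCC space; and if $X$ is a CCC space and $g:X\to Y$ is a continuous surjection onto a topological space $Y$, then $Y$ is a CCC space.
   Context: A topological space $X$ is a CCC space if it is a continuous image of a product of a compact space and a connected space, i.e. there exist a compact space $K$, a connected space $C$ and a continuous surjection $f:K\times C\to X$. No separation axioms are assumed; compact means that every open cover has a finite subcover. *)

theory Defs
  imports "HOL-Analysis.Analysis"
begin

text \<open>
  HOL cannot quantify over types inside a formula, so the types of the points of the compact and the
  connected factor are parameters. By the lemma \<open>ccc_space_mono\<close> below, they only bound the
  cardinalities of the two factors: a space is CCC iff \<open>ccc_space\<close> holds of it for some types, and
  the spaces of a family of CCC spaces are CCC with respect to common, sufficiently large types.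
\<close>

definition ccc_space :: "'k itself \<Rightarrow> 'c itself \<Rightarrow> 'a topology \<Rightarrow> bool" where
  "ccc_space TK TC X \<longleftrightarrow>
    (\<exists>(K :: 'k topology) (C :: 'c topology) f.
       compact_space K \<and> connected_space C \<and>
       continuous_map (prod_topology K C) X f \<and>
       f ` topspace (prod_topology K C) = topspace X)"

lemma transport_topology:
  fixes h :: "'a \<Rightarrow> 'b" and T :: "'a topology"
  assumes h: "inj h"
  shows "\<exists>T'. homeomorphic_map T' T (inv h)"
proof -
  define T' where "T' = pullback_topology (range h) (inv h) T"
  have top: "topspace T' = h ` topspace T"
    using h by (auto simp: T'_def topspace_pullback_topology)
  have "continuous_map T' T (inv h)"
    unfolding T'_def using continuous_map_pullback[of T T id] by (simp add: o_def)
  moreover have "continuous_map T T' h"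
    unfolding T'_def
    by (rule continuous_map_pullback') (use h in \<open>auto simp: o_def\<close>)
  ultimately have "homeomorphic_maps T' T (inv h) h"
    using h by (auto simp: homeomorphic_maps_def top)
  then show ?thesis
    using homeomorphic_maps_map by blast
qed

lemma ccc_space_mono:
  fixes X :: "'a topology" and h :: "'k \<Rightarrow> 'l" and j :: "'c \<Rightarrow> 'd"
  assumes "ccc_space TYPE('k) TYPE('c) X" and "inj h" and "inj j"
  shows "ccc_space TYPE('l) TYPE('d) X"
proof -
  obtain K :: "'k topology" and C :: "'c topology" and f where
    K: "compact_space K" and C: "connected_space C"
    and f: "continuous_map (prod_topology K C) X f" "f ` topspace (prod_topology K C) = topspace X"
    using assms(1) unfolding ccc_space_def by blast
  obtain L D where L: "homeomorphic_map L K (inv h)" and D: "homeomorphic_map D C (inv j)"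
    using transport_topology assms(2,3) by metis
  let ?p = "\<lambda>(x, y). (inv h x, inv j y)"
  have p: "continuous_map (prod_topology L D) (prod_topology K C) ?p"
    using L D by (simp add: continuous_map_prod_top homeomorphic_imp_continuous_map)
  have s: "?p ` topspace (prod_topology L D) = topspace (prod_topology K C)"
    using homeomorphic_imp_surjective_map[OF L] homeomorphic_imp_surjective_map[OF D]
    by (force simp: image_paired_Times)
  have "compact_space L"
    using K L homeomorphic_compact_space homeomorphic_map_imp_homeomorphic_space by blast
  moreover have "connected_space D"
    using C D homeomorphic_connected_space homeomorphic_map_imp_homeomorphic_space by blast
  moreover have "continuous_map (prod_topology L D) X (f \<circ> ?p)"
    using continuous_map_compose[OF p f(1)] .
  moreover have "(f \<circ> ?p) ` topspace (prod_topology L D) = topspace X"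
    using s f(2) by (simp only: image_comp [symmetric])
  ultimately show ?thesis
    unfolding ccc_space_def by blast
qed

end

theory Submission
  imports Defs
begin

text \<open>
  A product of continuous surjections \<open>f i : K i \<times> C i \<rightarrow> X i\<close> is a continuous surjection from
  \<open>\<Prod>i. (K i \<times> C i)\<close> onto \<open>\<Prod>i. X i\<close>, and after regrouping the coordinates its domain is
  \<open>(\<Prod>i. K i) \<times> (\<Prod>i. C i)\<close>. The first factor is compact by Tychonoff's theorem, and the second
  is connected since arbitrary products of connected spaces are connected. For continuous images,
  a surjection \<open>K \<times> C \<rightarrow> X\<close> is composed with the map \<open>X \<rightarrow> Y\<close>.
\<close>

text \<open>
  Continuity holds because each coordinate factors through the projections to the \<open>i\<close>-th factors.
  Surjectivity is the axiom of choice: preimages are chosen separately in each coordinate.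
\<close>

lemma product_of_surjections_from_prod_topology:
  fixes K :: "'i \<Rightarrow> 'k topology" and C :: "'i \<Rightarrow> 'c topology" and X :: "'i \<Rightarrow> 'a topology"
  assumes cont: "\<And>i. i \<in> I \<Longrightarrow> continuous_map (prod_topology (K i) (C i)) (X i) (f i)"
    and surj: "\<And>i. i \<in> I \<Longrightarrow> f i ` topspace (prod_topology (K i) (C i)) = topspace (X i)"
  defines "F \<equiv> \<lambda>(k, c). \<lambda>i\<in>I. f i (k i, c i)"
  shows "continuous_map (prod_topology (product_topology K I) (product_topology C I))
           (product_topology X I) F"
    and "F ` topspace (prod_topology (product_topology K I) (product_topology C I))
           = topspace (product_topology X I)"
proof -
  let ?P = "prod_topology (product_topology K I) (product_topology C I)"
  show F: "continuous_map ?P (product_topology X I) F"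
    unfolding continuous_map_componentwise
  proof (intro conjI ballI)
    show "F ` topspace ?P \<subseteq> extensional I"
      by (auto simp: F_def)
  next
    fix i assume i: "i \<in> I"
    have "continuous_map ?P (prod_topology (K i) (C i)) (\<lambda>p. (fst p i, snd p i))"
      unfolding continuous_map_paired
      using continuous_map_compose
          [OF continuous_map_fst continuous_map_product_projection[OF i, of K],
            of "product_topology C I"]
        continuous_map_compose
          [OF continuous_map_snd continuous_map_product_projection[OF i, of C],
            of "product_topology K I"]
      by (simp add: o_def)
    from continuous_map_compose[OF this cont[OF i]]
    show "continuous_map ?P (X i) (\<lambda>p. F p i)"
      using i by (simp add: F_def o_def case_prod_beta)
  qed
  show "F ` topspace ?P = topspace (product_topology X I)"
  proof
    show "F ` topspace ?P \<subseteq> topspace (product_topology X I)"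
      using F by (rule continuous_map_image_subset_topspace)
  next
    show "topspace (product_topology X I) \<subseteq> F ` topspace ?P"
    proof
      fix x assume x: "x \<in> topspace (product_topology X I)"
      have "\<forall>i\<in>I. \<exists>k c. k \<in> topspace (K i) \<and> c \<in> topspace (C i) \<and> f i (k, c) = x i"
      proof
        fix i assume i: "i \<in> I"
        have "x i \<in> f i ` topspace (prod_topology (K i) (C i))"
          unfolding surj[OF i] using x i by (auto simp: PiE_iff)
        then obtain a b where "a \<in> topspace (K i)" "b \<in> topspace (C i)" "f i (a, b) = x i"
          by auto
        then show "\<exists>k c. k \<in> topspace (K i) \<and> c \<in> topspace (C i) \<and> f i (k, c) = x i"
          by (intro exI conjI)
      qed
      then obtain k c where kc:
          "\<forall>i\<in>I. k i \<in> topspace (K i) \<and> c i \<in> topspace (C i) \<and> f i (k i, c i) = x i"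
        unfolding bchoice_iff by (elim exE)
      have "F (restrict k I, restrict c I) = x"
        using x kc by (auto simp: F_def PiE_iff extensional_def)
      moreover have "(restrict k I, restrict c I) \<in> topspace ?P"
        using kc by auto
      ultimately show "x \<in> F ` topspace ?P"
        by (rule rev_image_eqI[OF _ sym, rotated])
    qed
  qed
qed

lemma ccc_space_product_topology:
  fixes X :: "'i \<Rightarrow> 'a topology"
  assumes "\<And>i. i \<in> I \<Longrightarrow> ccc_space TYPE('k) TYPE('c) (X i)"
  shows "ccc_space TYPE('i \<Rightarrow> 'k) TYPE('i \<Rightarrow> 'c) (product_topology X I)"
proof -
  have "\<forall>i\<in>I. \<exists>(K :: 'k topology) (C :: 'c topology) f. compact_space K \<and> connected_space C \<and>
      continuous_map (prod_topology K C) (X i) f \<and> f ` topspace (prod_topology K C) = topspace (X i)"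
    using assms unfolding ccc_space_def by blast
  then obtain K :: "'i \<Rightarrow> 'k topology" and C :: "'i \<Rightarrow> 'c topology" and f where
    "\<forall>i\<in>I. compact_space (K i) \<and> connected_space (C i) \<and>
      continuous_map (prod_topology (K i) (C i)) (X i) (f i) \<and>
      f i ` topspace (prod_topology (K i) (C i)) = topspace (X i)"
    unfolding bchoice_iff by (elim exE)
  then have KC: "\<And>i. i \<in> I \<Longrightarrow> compact_space (K i)" "\<And>i. i \<in> I \<Longrightarrow> connected_space (C i)"
    and f: "\<And>i. i \<in> I \<Longrightarrow> continuous_map (prod_topology (K i) (C i)) (X i) (f i)"
      "\<And>i. i \<in> I \<Longrightarrow> f i ` topspace (prod_topology (K i) (C i)) = topspace (X i)"
    by blast+
  have "compact_space (product_topology K I)"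
    using KC(1) by (simp add: compact_space_product_topology)
  moreover have "connected_space (product_topology C I)"
    using KC(2) by (simp add: connected_space_product_topology)
  ultimately show ?thesis
    unfolding ccc_space_def
    using product_of_surjections_from_prod_topology[of I K C X f, OF f] by (intro exI conjI)
qed

lemma ccc_space_continuous_image:
  fixes X :: "'a topology" and Y :: "'b topology"
  assumes "ccc_space TYPE('k) TYPE('c) X"
    and g: "continuous_map X Y g" "g ` topspace X = topspace Y"
  shows "ccc_space TYPE('k) TYPE('c) Y"
proof -
  obtain K :: "'k topology" and C :: "'c topology" and f where
    KC: "compact_space K" "connected_space C"
    and f: "continuous_map (prod_topology K C) X f" "f ` topspace (prod_topology K C) = topspace X"
    using assms(1) unfolding ccc_space_def by blast
  have "(g \<circ> f) ` topspace (prod_topology K C) = topspace Y"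
    using f(2) g(2) by (simp only: image_comp [symmetric])
  then show ?thesis
    unfolding ccc_space_def using KC continuous_map_compose[OF f(1) g(1)] by blast
qed

theorem proposition3:
  shows "(\<forall>(I :: 'i set) (X :: 'i \<Rightarrow> 'a topology).
            (\<forall>i\<in>I. ccc_space TYPE('k) TYPE('c) (X i)) \<longrightarrow>
            ccc_space TYPE('i \<Rightarrow> 'k) TYPE('i \<Rightarrow> 'c) (product_topology X I))
       \<and> (\<forall>(X :: 'a topology) (Y :: 'b topology) g.
            ccc_space TYPE('k) TYPE('c) X \<longrightarrow>
            continuous_map X Y g \<longrightarrow> g ` topspace X = topspace Y \<longrightarrow>
            ccc_space TYPE('k) TYPE('c) Y)"
  by (intro conjI allI impI)
    (rule ccc_space_product_topology, erule (1) bspec, rule ccc_space_continuous_image)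

end
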